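(* Suppose there exist constants $\bar\Delta,\sigma>0$ such that for all $t\ge 0$ one has $\mathbb{E}\,\bar\Delta_t^2\le\bar\Delta^2$, where $\bar\Delta_t=\|\bar x_t-\bar x_{t+1}\|$, and $\mathbb{E}\|z_t\|^2\le\sigma^2$. Suppose $\bar\Delta/\sigma<\sqrt{\bar\mu/(16L^3)}$. Set $\bar\eta_\star=(2\bar\Delta^2/(\bar\mu\sigma^2))^{1/3}$ and $\bar{\mathcal{E}}=(\bar\Delta\sigma^2/\bar\mu^2)^{2/3}$, and let $D>0$ satisfy $D\ge\|x_0-\bar x_0\|^2$. Run the decision-dependent proximal stochastic gradient method in epochs $k=0,\dots,K-1$: set $X_0=x_0$ and let $X_{k+1}$ be the output of the method started at $X_k$ and run for $T_k$ steps with constant step size $\eta_k$, where $$K=1+\left\lceil\log_2\left(\frac1L\left(\frac{\sigma^2\bar\mu}{\bar\Delta^2}\right)^{1/3}\right)\right\rceil,\qquad \eta_0=\frac1{2L},\qquad T_0=\left\lceil\frac{2L}{\bar\mu}\log\left(\frac{\bar\mu LD}{\sigma^2}\right)^+\right\rceil,$$ and, for all $k\ge1$, $$\eta_k=\frac{\eta_{k-1}+\bar\eta_\star}{2},\qquad T_k=\left\lceil\frac{\log 4}{\bar\mu\eta_k}\right\rceil.$$ Then the time horizon $T=T_0+\cdots+T_{K-1}$ satisfies $$T\lesssim\frac{L}{\bar\mu}\log\left(\frac{\bar\mu LD}{\sigma^2}\right)^++\frac{\sigma^2}{\bar\mu^2\bar{\mathcal{E}}}\le\frac{L}{\bar\mu}\log\left(\frac{D}{\bar{\mathcal{E}}}\right)^++\frac{\sigma^2}{\bar\mu^2\bar{\mathcal{E}}},$$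 and the tracking error satisfies $\mathbb{E}\|X_K-\bar X_K\|^2\lesssim\bar{\mathcal{E}}$, where $\bar X_K:=\bar x_T$ is the minimizer of $\psi_T$.
   Context: Notation: $\mathbb{N}=\{0,1,2,\dots\}$; $\mathbb{R}^d$ carries the Euclidean inner product $\langle\cdot,\cdot\rangle$ and norm $\|\cdot\|$; $a^+=\max\{a,0\}$, and $\log(s)^+$ means $(\log s)^+$; $A\lesssim B$ means $A\le CB$ for an absolute numerical constant $C>0$ independent of all problem parameters. Problem family. For each $t\in\mathbb{N}$ and $x\in\mathbb{R}^d$, $f_{t,x}\colon\mathbb{R}^d\to\mathbb{R}$ is $\mu$-strongly convex and $C^1$-smooth with $L$-Lipschitz gradient, for common constants $\mu,L>0$; $\nabla f_{t,x}(u)$ denotes the gradient of $f_{t,x}(\cdot)$ at $u$. For each $t$, $r_t\colon\mathbb{R}^d\to\mathbb{R}\cup\{\infty\}$ is proper, closed, convex. Set $$\gamma:=\sup_{t\in\mathbb{N},\,u,x,y\in\mathbb{R}^d,\,x\ne y}\frac{\|\nabla f_{t,x}(u)-\nabla f_{t,y}(u)\|}{\|x-y\|},$$ and assume $\gamma<\mu$. Set $\bar\mu:=\mu-\gamma>0$. The functions may be random (the problem may evolve stochastically), with these conditions holding for every outcome with deterministic $\mu,L,\gamma$. Equilibria. For each $t$ there is a unique point $\bar x_t$ with $\bar x_t\in\operatorname{argmin}_{u\in\mathbb{R}^d}\{f_{t,\bar x_t}(u)+r_t(u)\}$. Set $\psi_t:=f_{t,\bar x_t}+r_t$; its minimizer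 is $\bar x_t$. Algorithm (decision-dependent proximal stochastic gradient method). At time $t$, with current iterate $x_t$ and step size $\eta>0$, a stochastic gradient $g_t$ (estimator of $\nabla f_{t,x_t}(x_t)$) is obtained and $$x_{t+1}=\operatorname{prox}_{\eta r_t}(x_t-\eta g_t)=\operatorname{argmin}_{u\in\mathbb{R}^d}\left\{r_t(u)+\tfrac{1}{2\eta}\|u-(x_t-\eta g_t)\|^2\right\}.$$ The gradient noise is $z_t:=\nabla f_{t,x_t}(x_t)-g_t$. When run in epochs, time continues across epochs: with $t_k=T_0+\cdots+T_{k-1}$ (and $t_0=0$), epoch $k$ uses the times $t=t_k,\dots,t_k+T_k-1$, starts at $x_{t_k}=X_k$, uses the constant step size $\eta_k$, and outputs $X_{k+1}=x_{t_{k+1}}$. Stochastic framework. There is a probability space $(\Omega,\mathcal{F},\mathbb{P})$ with filtration $(\mathcal{F}_t)_{t\ge0}$, $\mathcal{F}_0=\{\emptyset,\Omega\}$, such that for all $t\ge0$: $x_t,\bar x_t\colon\Omega\to\mathbb{R}^d$ are $\mathcal{F}_t$-measurable, and $z_t\colon\Omega\to\mathbb{R}^d$ is $\mathcal{F}_{t+1}$-measurable with $\mathbb{E}[z_t\mid\mathcal{F}_t]=0$. *)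

theory Defs
  imports "HOL-Probability.Probability"
begin

definition gradient :: "('a::real_inner \<Rightarrow> real) \<Rightarrow> 'a \<Rightarrow> 'a" where
  "gradient h u = (THE D. GDERIV h u :> D)"

definition strongly_convex :: "real \<Rightarrow> ('a::real_inner \<Rightarrow> real) \<Rightarrow> bool" where
  "strongly_convex \<mu> h \<longleftrightarrow> convex_on UNIV (\<lambda>u. h u - \<mu> / 2 * (norm u)\<^sup>2)"

text \<open>Lipschitz continuity of the gradient makes the differentiable function continuously
  differentiable.\<close>

definition smooth_function :: "real \<Rightarrow> ('a::real_inner \<Rightarrow> real) \<Rightarrow> bool" where
  "smooth_function L h \<longleftrightarrow> (\<forall>u. h differentiable (at u)) \<and> L-lipschitz_on UNIV (gradient h)"

definition ereal_epigraph :: "('a \<Rightarrow> ereal) \<Rightarrow> ('a \<times> real) set" where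
  "ereal_epigraph r = {(u, s). r u \<le> ereal s}"

definition proper_closed_convex :: "('a::real_normed_vector \<Rightarrow> ereal) \<Rightarrow> bool" where
  "proper_closed_convex r \<longleftrightarrow>
     (\<forall>u. r u \<noteq> -\<infinity>) \<and> (\<exists>u. r u \<noteq> \<infinity>) \<and>
     closed (ereal_epigraph r) \<and> convex (ereal_epigraph r)"

definition prox :: "real \<Rightarrow> ('a::real_normed_vector \<Rightarrow> ereal) \<Rightarrow> 'a \<Rightarrow> 'a" where
  "prox \<eta> r y = arg_min (\<lambda>u. r u + ereal (1 / (2 * \<eta>) * (norm (u - y))\<^sup>2)) (\<lambda>_. True)"

text \<open>In \<open>f t \<omega> x u\<close> the point \<open>x\<close> is the decision that determines the loss, and \<open>u\<close> is its
  argument. The outcome \<open>\<omega>\<close> is a parameter because the problem may be random.\<close>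

definition shift_sensitivity ::
    "'w set \<Rightarrow> (nat \<Rightarrow> 'w \<Rightarrow> 'a::real_inner \<Rightarrow> 'a \<Rightarrow> real) \<Rightarrow> ereal" where
  "shift_sensitivity \<Omega> f =
     Sup {ereal (norm (gradient (f t \<omega> x) u - gradient (f t \<omega> y) u) / norm (x - y)) |
          t \<omega> u x y. \<omega> \<in> \<Omega> \<and> x \<noteq> y}"

locale decision_dependent_problem =
  fixes \<Omega> :: "'w set"
    and f :: "nat \<Rightarrow> 'w \<Rightarrow> 'a::euclidean_space \<Rightarrow> 'a \<Rightarrow> real"
    and r :: "nat \<Rightarrow> 'w \<Rightarrow> 'a \<Rightarrow> ereal"
    and \<mu> L \<gamma> :: real
  assumes mu_pos: "0 < \<mu>"
    and L_pos: "0 < L"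
    and f_strongly_convex: "\<And>t \<omega> x. \<omega> \<in> \<Omega> \<Longrightarrow> strongly_convex \<mu> (f t \<omega> x)"
    and f_smooth: "\<And>t \<omega> x. \<omega> \<in> \<Omega> \<Longrightarrow> smooth_function L (f t \<omega> x)"
    and r_proper_closed_convex: "\<And>t \<omega>. \<omega> \<in> \<Omega> \<Longrightarrow> proper_closed_convex (r t \<omega>)"
    and gamma_eq: "ereal \<gamma> = shift_sensitivity \<Omega> f"
    and gamma_less_mu: "\<gamma> < \<mu>"

definition is_equilibrium ::
    "('a \<Rightarrow> 'a \<Rightarrow> real) \<Rightarrow> ('a \<Rightarrow> ereal) \<Rightarrow> 'a \<Rightarrow> bool" where
  "is_equilibrium h r x \<longleftrightarrow> is_arg_min (\<lambda>u. ereal (h x u) + r u) (\<lambda>_. True) x"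

definition gradient_noise ::
    "(nat \<Rightarrow> 'w \<Rightarrow> 'a::real_inner \<Rightarrow> 'a \<Rightarrow> real) \<Rightarrow> (nat \<Rightarrow> 'w \<Rightarrow> 'a) \<Rightarrow> (nat \<Rightarrow> 'w \<Rightarrow> 'a) \<Rightarrow>
     nat \<Rightarrow> 'w \<Rightarrow> 'a" where
  "gradient_noise f x g t \<omega> = gradient (f t \<omega> (x t \<omega>)) (x t \<omega>) - g t \<omega>"

text \<open>\<^const>\<open>real_cond_exp\<close> is real-valued, so a vanishing vector-valued conditional
  expectation is expressed by coordinates. Integrability is part of the predicate because
  \<^const>\<open>real_cond_exp\<close> is a total function.\<close>

definition cond_mean_zero :: "'w measure \<Rightarrow> 'w measure \<Rightarrow> ('w \<Rightarrow> 'a::euclidean_space) \<Rightarrow> bool" where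
  "cond_mean_zero M G z \<longleftrightarrow>
     integrable M z \<and> (\<forall>b\<in>Basis. AE \<omega> in M. real_cond_exp M G (\<lambda>\<omega>. z \<omega> \<bullet> b) \<omega> = 0)"

locale stochastic_framework = prob_space M + filtration "space M" F
  for M :: "'w measure" and F :: "nat \<Rightarrow> 'w measure" +
  fixes x xbar z :: "nat \<Rightarrow> 'w \<Rightarrow> 'a::euclidean_space"
  assumes F_subalgebra: "\<And>t. subalgebra M (F t)"
    and F_0: "sets (F 0) = {{}, space M}"
    and x_measurable: "\<And>t. x t \<in> borel_measurable (F t)"
    and xbar_measurable: "\<And>t. xbar t \<in> borel_measurable (F t)"
    and z_measurable: "\<And>t. z t \<in> borel_measurable (F (Suc t))"
    and z_cond_mean_zero: "\<And>t. cond_mean_zero M (F t) (z t)"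

text \<open>The absolute constant behind the order bounds. An existentially quantified constant in a
  theorem with free type variables could depend on the types, hence on the dimension of the
  space; a fixed number cannot. No attempt is made to optimise it.\<close>

definition abs_const :: real where
  "abs_const = 100"

end

theory Submission
  imports Defs
begin

text \<open>Write \<open>m = \<mu> - \<gamma>\<close> and \<open>b\<close> for the equilibrium at time \<open>t\<close>. Both \<open>b\<close> and the proximal point
  \<open>x'\<close> satisfy first-order optimality conditions for the same convex function \<open>r\<close>; combining them
  with strong convexity, the descent lemma and the \<open>\<gamma>\<close>-Lipschitz dependence on the decision gives
  \<open>(1 + \<eta> m) |x' - b|\<^sup>2 \<le> (1 - \<eta> m) |x - b|\<^sup>2 + 2 \<eta> \<langle>z, x - b\<rangle> + 2 \<eta>\<^sup>2 |z|\<^sup>2\<close>. Taking expectations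
  kills the inner product, and moving from one equilibrium to the next costs a factor \<open>1 + \<eta> m\<close>, so
  the squared error contracts by \<open>1 - \<eta> m\<close> up to a stationary error which is at most
  \<open>(11/4) \<eta> \<sigma>\<^sup>2 / m\<close> while \<open>\<eta> \<ge> \<eta>\<^sub>\<star>\<close>. An epoch divides the inherited error by \<open>4\<close> while the step
  size at most halves, whence the error after epoch \<open>k\<close> is at most \<open>(11/2) \<eta>\<^sub>k \<sigma>\<^sup>2 / m\<close>; after \<open>K\<close>
  epochs \<open>\<eta>\<^sub>k\<close> is comparable to \<open>\<eta>\<^sub>\<star>\<close>. The epoch lengths grow geometrically, so the last one
  dominates the horizon.\<close>

section \<open>Convex analysis and the proximal step\<close>

text \<open>\<open>gradient\<close> is a definite description, so existence and uniqueness are both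
  due: the derivative on \<open>Basis\<close> assembles a representing vector, and two such vectors
  agree when tested on their difference.\<close>

lemma differentiable_imp_GDERIV_gradient:
  fixes h :: "'a::euclidean_space \<Rightarrow> real"
  assumes "h differentiable (at u)"
  shows "GDERIV h u :> gradient h u"
proof -
  obtain h' where h': "(h has_derivative h') (at u)"
    using assms by (auto simp: differentiable_def)
  define D where "D = (\<Sum>b\<in>Basis. h' b *\<^sub>R b)"
  interpret bounded_linear h' using h' by (rule has_derivative_bounded_linear)
  have "h' = (\<lambda>v. v \<bullet> D)"
  proof
    fix v
    have "h' v = h' (\<Sum>b\<in>Basis. (v \<bullet> b) *\<^sub>R b)" by (simp add: euclidean_representation)
    also have "\<dots> = v \<bullet> D" by (simp add: sum scale D_def inner_sum_right mult.commute)
    finally show "h' v = v \<bullet> D" .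
  qed
  then have D: "GDERIV h u :> D" using h' by (simp add: gderiv_def)
  moreover have "E = D" if "GDERIV h u :> E" for E
  proof -
    have "(\<lambda>v. v \<bullet> E) = (\<lambda>v. v \<bullet> D)"
      using that D unfolding gderiv_def by (rule has_derivative_unique)
    then have "(E - D) \<bullet> E = (E - D) \<bullet> D" by (rule fun_cong)
    then have "(E - D) \<bullet> (E - D) = 0" by (simp add: inner_diff_right)
    then show ?thesis by simp
  qed
  ultimately show ?thesis
    unfolding gradient_def by (rule theI)
qed

lemma GDERIV_line:
  assumes "GDERIV h (p + t *\<^sub>R v) :> D"
  shows "((\<lambda>t. h (p + t *\<^sub>R v)) has_real_derivative v \<bullet> D) (at t)"
proof -
  have "((\<lambda>t. p + t *\<^sub>R v) has_derivative (\<lambda>s. s *\<^sub>R v)) (at t)"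
    by (auto intro!: derivative_eq_intros)
  from has_derivative_compose[OF this assms[unfolded gderiv_def]]
  show ?thesis by (simp add: has_field_derivative_def mult_commute_abs)
qed

text \<open>Limit of the difference quotient from the right. It serves both for a negated convex
  function and for the smooth term at a minimizer.\<close>

lemma GDERIV_ge_of_linear_minorant:
  assumes "GDERIV h p :> D"
    and "\<And>t. 0 < t \<Longrightarrow> t \<le> 1 \<Longrightarrow> t * c \<le> h (p + t *\<^sub>R v) - h p"
  shows "c \<le> D \<bullet> v"
proof -
  have "((\<lambda>t. h (p + t *\<^sub>R v)) has_real_derivative v \<bullet> D) (at 0)"
    using assms(1) by (intro GDERIV_line) simp
  then have "((\<lambda>t. (h (p + t *\<^sub>R v) - h p) / t) \<longlongrightarrow> v \<bullet> D) (at_right 0)"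
    by (auto simp: has_field_derivative_iff intro: filterlim_mono at_le)
  moreover have "\<forall>\<^sub>F t in at_right 0. c \<le> (h (p + t *\<^sub>R v) - h p) / t"
    using eventually_at_right_less[of "0::real"]
      eventually_at_right_real[of "0::real" 1, simplified]
    proof eventually_elim
      case (elim t)
      then show ?case using assms(2)[of t] by (simp add: field_simps)
    qed
  ultimately show ?thesis
    by (simp add: tendsto_lowerbound inner_commute)
qed

text \<open>Removing the quadratic leaves a convex function, whose chords bound its increments from
  above; negation turns this into a linear minorant.\<close>

lemma strongly_convex_gradient_ineq:
  fixes h :: "'a::euclidean_space \<Rightarrow> real"
  assumes sc: "strongly_convex \<mu> h" and diff: "h differentiable (at u)"
  shows "h v \<ge> h u + gradient h u \<bullet> (v - u) + \<mu> / 2 * (norm (v - u))\<^sup>2"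
proof -
  define \<phi> where "\<phi> w = h w - \<mu> / 2 * (norm w)\<^sup>2" for w
  have cvx: "convex_on UNIV \<phi>" using sc by (simp add: strongly_convex_def \<phi>_def[abs_def])
  have "((\<lambda>w. - \<phi> w) has_derivative
      (\<lambda>w. - (w \<bullet> gradient h u - \<mu> / 2 * (2 * (u \<bullet> w))))) (at u)"
    unfolding \<phi>_def power2_norm_eq_inner
    by (auto intro!: derivative_eq_intros
        differentiable_imp_GDERIV_gradient[OF diff, unfolded gderiv_def] simp: inner_commute)
  then have "GDERIV (\<lambda>w. - \<phi> w) u :> - (gradient h u - \<mu> *\<^sub>R u)"
    by (simp add: gderiv_def inner_diff_right inner_commute algebra_simps)
  moreover have "t * - (\<phi> v - \<phi> u) \<le> - \<phi> (u + t *\<^sub>R (v - u)) - - \<phi> u"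
    if t: "0 < t" "t \<le> 1" for t
  proof -
    have "\<phi> ((1 - t) *\<^sub>R u + t *\<^sub>R v) \<le> (1 - t) * \<phi> u + t * \<phi> v"
      using convex_onD[OF cvx, of t u v] t by simp
    moreover have "(1 - t) *\<^sub>R u + t *\<^sub>R v = u + t *\<^sub>R (v - u)"
      by (simp add: algebra_simps)
    ultimately show ?thesis by (simp add: algebra_simps)
  qed
  ultimately have "- (\<phi> v - \<phi> u) \<le> - (gradient h u - \<mu> *\<^sub>R u) \<bullet> (v - u)"
    by (rule GDERIV_ge_of_linear_minorant)
  then show ?thesis
    unfolding \<phi>_def power2_norm_eq_inner
    by (simp add: algebra_simps inner_commute)
qed

lemma smooth_function_descent:
  fixes h :: "'a::euclidean_space \<Rightarrow> real"
  assumes sm: "smooth_function L h"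
  shows "h v \<le> h u + gradient h u \<bullet> (v - u) + L / 2 * (norm (v - u))\<^sup>2"
proof -
  define d where "d = v - u"
  \<comment> \<open>Value along the segment minus the non-constant part of the quadratic model; the
    claim is that it does not increase from 0 to 1.\<close>
  define \<phi> where "\<phi> t = h (u + t *\<^sub>R d) - t * (gradient h u \<bullet> d) - L / 2 * t\<^sup>2 * (norm d)\<^sup>2" for t
  have diff: "h differentiable (at w)" for w using sm by (simp add: smooth_function_def)
  have deriv: "(\<phi> has_real_derivative
      (d \<bullet> gradient h (u + t *\<^sub>R d) - gradient h u \<bullet> d - L * t * (norm d)\<^sup>2)) (at t)" for t
    unfolding \<phi>_def
    by (auto intro!: derivative_eq_intros GDERIV_line differentiable_imp_GDERIV_gradient diff)
  have le: "d \<bullet> gradient h (u + t *\<^sub>R d) - gradient h u \<bullet> d - L * t * (norm d)\<^sup>2 \<le> 0"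
    if "0 \<le> t" for t
  proof -
    have "L-lipschitz_on UNIV (gradient h)" using sm by (simp add: smooth_function_def)
    from lipschitz_onD[OF this, of "u + t *\<^sub>R d" u]
    have "norm (gradient h (u + t *\<^sub>R d) - gradient h u) \<le> L * (t * norm d)"
      using that by (simp add: dist_norm)
    then have "(gradient h (u + t *\<^sub>R d) - gradient h u) \<bullet> d \<le> L * (t * norm d) * norm d"
      by (meson mult_right_mono norm_cauchy_schwarz norm_ge_zero order_trans)
    then show ?thesis
      by (simp add: inner_commute inner_diff_left inner_diff_right power2_eq_square algebra_simps)
  qed
  have "\<exists>y. (\<phi> has_real_derivative y) (at t) \<and> y \<le> 0" if "0 \<le> t" for t
    using deriv le[OF that] by (intro exI conjI)
  then have "\<phi> 1 \<le> \<phi> 0"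
    by (intro DERIV_nonpos_imp_nonincreasing[of 0 1]) auto
  then show ?thesis by (simp add: \<phi>_def d_def algebra_simps)
qed

text \<open>Compare the quadratic lower and upper bounds at a unit vector. This is what later keeps
  \<open>\<eta> k * m\<close> at most 1/2.\<close>

lemma strongly_convex_smooth_le:
  fixes h :: "'a::euclidean_space \<Rightarrow> real"
  assumes "strongly_convex \<mu> h" and "smooth_function L h"
  shows "\<mu> \<le> L"
proof -
  obtain b :: 'a where b: "b \<in> Basis" using nonempty_Basis by blast
  have diff: "h differentiable (at 0)" using assms(2) by (simp add: smooth_function_def)
  show ?thesis
    using strongly_convex_gradient_ineq[OF assms(1) diff, of b]
      smooth_function_descent[OF assms(2), of b 0] b by simp
qed

text \<open>Fermat's rule: \<open>- D\<close> is a subgradient of \<open>r\<close> at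
  \<open>p\<close>. Convexity bounds \<open>r\<close> on the segment towards \<open>u\<close>, so
  minimality forces \<open>h\<close> to grow at least linearly there. Both the equilibrium and the
  proximal point get their optimality condition from it.\<close>

lemma arg_min_subgradient:
  fixes r :: "'a::real_inner \<Rightarrow> ereal"
  assumes conv: "convex (ereal_epigraph r)" and p: "r p = ereal s"
    and min: "\<And>u. r p + ereal (h p) \<le> r u + ereal (h u)"
    and D: "GDERIV h p :> D"
  shows "ereal (s - D \<bullet> (u - p)) \<le> r u"
proof (rule ereal_le_real)
  fix a assume a: "r u \<le> ereal a"
  have "t * (s - a) \<le> h (p + t *\<^sub>R (u - p)) - h p" if t: "0 < t" "t \<le> 1" for t
  proof -
    have "(p, s) \<in> ereal_epigraph r" "(u, a) \<in> ereal_epigraph r"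
      using p a by (auto simp: ereal_epigraph_def)
    from convexD_alt[OF conv this, of t] t
    have "((1 - t) *\<^sub>R p + t *\<^sub>R u, (1 - t) * s + t * a) \<in> ereal_epigraph r" by simp
    moreover have "(1 - t) *\<^sub>R p + t *\<^sub>R u = p + t *\<^sub>R (u - p)" by (simp add: algebra_simps)
    ultimately have "r (p + t *\<^sub>R (u - p)) \<le> ereal ((1 - t) * s + t * a)"
      by (simp add: ereal_epigraph_def)
    then have "ereal (s + h p) \<le> ereal ((1 - t) * s + t * a) + ereal (h (p + t *\<^sub>R (u - p)))"
      using min[of "p + t *\<^sub>R (u - p)"] p by (metis add_right_mono order_trans plus_ereal.simps(1))
    then show ?thesis by (simp add: algebra_simps)
  qed
  with D have "s - a \<le> D \<bullet> (u - p)" by (rule GDERIV_ge_of_linear_minorant)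
  then show "ereal (s - D \<bullet> (u - p)) \<le> ereal a" by simp
qed

text \<open>\<open>arg_min\<close> is meaningful only once a minimizer exists. The affine minorant
  of \<open>r\<close> makes the regularized objective coercive, and closedness of the epigraph then
  gives a compact set to minimize over.\<close>

lemma prox_is_minimizer:
  fixes r :: "'a::euclidean_space \<Rightarrow> ereal"
  assumes r: "proper_closed_convex r" and \<eta>: "0 < \<eta>"
    and b: "r b = ereal s" and minorant: "\<And>u. ereal (s + D \<bullet> (u - b)) \<le> r u"
  shows "r (prox \<eta> r y) + ereal (1 / (2 * \<eta>) * (norm (prox \<eta> r y - y))\<^sup>2)
          \<le> r u + ereal (1 / (2 * \<eta>) * (norm (u - y))\<^sup>2)"
proof -
  define c where "c = 1 / (2 * \<eta>)"
  have c: "c > 0" using \<eta> by (simp add: c_def)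
  \<comment> \<open>On the epigraph the objective is continuous, although \<open>r\<close> itself
    need not be.\<close>
  define \<phi> where "\<phi> w = snd w + c * (norm (fst w - y))\<^sup>2" for w :: "'a \<times> real"
  define S where "S = {w \<in> ereal_epigraph r. \<phi> w \<le> \<phi> (b, s)}"
  have cont: "continuous_on A \<phi>" for A
    unfolding \<phi>_def by (intro continuous_intros)
  have "closed S"
  proof -
    have "S = ereal_epigraph r \<inter> {w. \<phi> w \<le> \<phi> (b, s)}" by (auto simp: S_def)
    moreover have "closed {w. \<phi> w \<le> \<phi> (b, s)}"
      by (intro closed_Collect_le cont continuous_on_const)
    ultimately show ?thesis using r by (simp add: proper_closed_convex_def closed_Int)
  qed
  moreover have "bounded S"
  proof -
    \<comment> \<open>Minorant and sublevel bound make \<open>c * q^2\<close> at most a constant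
      plus \<open>norm D * q\<close>; by Young's inequality half of \<open>c * q^2\<close> absorbs
      the linear term, leaving \<open>B\<close>.\<close>
    define B where "B = \<phi> (b, s) - s + norm D * norm (y - b) + (norm D)\<^sup>2 / (2 * c)"
    define R where "R = sqrt (2 * B / c)"
    have "norm (fst w - y) \<le> R \<and>
        \<bar>snd w\<bar> \<le> \<bar>\<phi> (b, s)\<bar> + \<bar>s\<bar> + norm D * (R + norm (y - b))" if w: "w \<in> S" for w
    proof -
      define q where "q = norm (fst w - y)"
      have "r (fst w) \<le> ereal (snd w)" using w by (auto simp: S_def ereal_epigraph_def)
      with minorant[of "fst w"] have "ereal (s + D \<bullet> (fst w - b)) \<le> ereal (snd w)"
        by (rule order_trans)
      moreover have "\<bar>D \<bullet> (fst w - b)\<bar> \<le> norm D * (q + norm (y - b))"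
      proof -
        have "norm (fst w - b) \<le> q + norm (y - b)"
          unfolding q_def using norm_triangle_ineq[of "fst w - y" "y - b"] by simp
        then show ?thesis
          by (meson Cauchy_Schwarz_ineq2 mult_left_mono norm_ge_zero order_trans)
      qed
      ultimately have lower: "s - norm D * (q + norm (y - b)) \<le> snd w" by simp
      have upper: "snd w + c * q\<^sup>2 \<le> \<phi> (b, s)" using w by (simp add: S_def \<phi>_def q_def)
      have "norm D * q \<le> c / 2 * q\<^sup>2 + (norm D)\<^sup>2 / (2 * c)"
      proof -
        have "0 \<le> (c * q - norm D)\<^sup>2 / (2 * c)" using c by simp
        also have "\<dots> = c / 2 * q\<^sup>2 + (norm D)\<^sup>2 / (2 * c) - norm D * q"
          using c by (simp add: field_simps power2_eq_square)
        finally show ?thesis by simp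
      qed
      then have "c / 2 * q\<^sup>2 \<le> B" using lower upper by (simp add: B_def algebra_simps)
      then have "q\<^sup>2 \<le> 2 * B / c" using c by (simp add: field_simps)
      then have q: "q \<le> R" unfolding R_def by (rule real_le_rsqrt)
      have "norm D * (q + norm (y - b)) \<le> norm D * (R + norm (y - b))"
        using q by (intro mult_left_mono) auto
      moreover have "0 \<le> c * q\<^sup>2" "0 \<le> norm D * (q + norm (y - b))"
        using c by (simp_all add: q_def)
      ultimately have "\<bar>snd w\<bar> \<le> \<bar>\<phi> (b, s)\<bar> + \<bar>s\<bar> + norm D * (R + norm (y - b))"
        using lower upper by linarith
      with q show ?thesis by (simp add: q_def)
    qed
    then have "S \<subseteq> cball y R \<times> cball 0 (\<bar>\<phi> (b, s)\<bar> + \<bar>s\<bar> + norm D * (R + norm (y - b)))"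
      by (force simp: dist_norm norm_minus_commute)
    then show ?thesis
      by (rule bounded_subset[OF bounded_Times[OF bounded_cball bounded_cball]])
  qed
  ultimately have "compact S" by (simp add: compact_eq_bounded_closed)
  moreover have bS: "(b, s) \<in> S" using b by (simp add: S_def ereal_epigraph_def)
  ultimately obtain w where w: "w \<in> S" "\<And>v. v \<in> S \<Longrightarrow> \<phi> w \<le> \<phi> v"
    using continuous_attains_inf[of S \<phi>] cont by blast
  \<comment> \<open>Outside \<open>S\<close> the objective exceeds its value at
    \<open>(b, s)\<close>, so the minimizer over \<open>S\<close> is global on the epigraph.\<close>
  have epi: "\<phi> w \<le> \<phi> v" if "v \<in> ereal_epigraph r" for v
    using that w(2)[of v] w(2)[OF bS] by (cases "\<phi> v \<le> \<phi> (b, s)") (auto simp: S_def)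
  let ?F = "\<lambda>u. r u + ereal (c * (norm (u - y))\<^sup>2)"
  have "?F (fst w) \<le> ?F u" for u
  proof -
    have "?F (fst w) \<le> ereal (\<phi> w)"
      using w(1) add_right_mono[of "r (fst w)" "ereal (snd w)" "ereal (c * (norm (fst w - y))\<^sup>2)"]
      by (simp add: S_def ereal_epigraph_def \<phi>_def case_prod_beta)
    also have "\<dots> \<le> ?F u"
    proof (cases "r u")
      case (real a)
      then show ?thesis using epi[of "(u, a)"] by (simp add: ereal_epigraph_def \<phi>_def)
    next
      case MInf
      then show ?thesis using r by (simp add: proper_closed_convex_def)
    qed simp
    finally show ?thesis .
  qed
  then have "is_arg_min ?F (\<lambda>_. True) (fst w)" by (simp add: is_arg_min_linorder)
  then have "is_arg_min ?F (\<lambda>_. True) (prox \<eta> r y)"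
    unfolding prox_def arg_min_def c_def by (rule someI)
  then show ?thesis by (simp add: is_arg_min_linorder c_def)
qed

lemma equilibrium_finite:
  assumes eq: "is_equilibrium h r b" and r: "proper_closed_convex r"
  obtains s where "r b = ereal s"
proof -
  obtain u where u: "r u \<noteq> \<infinity>" using r by (auto simp: proper_closed_convex_def)
  have "ereal (h b b) + r b \<le> ereal (h b u) + r u"
    using eq by (simp add: is_equilibrium_def is_arg_min_linorder)
  then have "r b \<noteq> \<infinity>" using u by auto
  moreover have "r b \<noteq> -\<infinity>" using r by (simp add: proper_closed_convex_def)
  ultimately show thesis using that by (cases "r b") auto
qed

section \<open>One proximal gradient step under decision dependence\<close>

context decision_dependent_problem
begin

lemma shift_lipschitz:
  assumes "\<omega> \<in> \<Omega>"
  shows "norm (gradient (f t \<omega> x) u - gradient (f t \<omega> y) u) \<le> \<gamma> * norm (x - y)"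
proof (cases "x = y")
  case False
  then have "ereal (norm (gradient (f t \<omega> x) u - gradient (f t \<omega> y) u) / norm (x - y)) \<le> ereal \<gamma>"
    unfolding gamma_eq shift_sensitivity_def using assms by (intro Sup_upper) blast
  with False show ?thesis by (simp add: field_simps)
qed simp

lemma gamma_nonneg:
  assumes "\<omega> \<in> \<Omega>"
  shows "0 \<le> \<gamma>"
proof -
  obtain b :: 'a where b: "b \<in> Basis" using nonempty_Basis by blast
  have "0 \<le> \<gamma> * norm (b - 0)"
    using shift_lipschitz[OF assms, of 0 b b 0] norm_ge_zero order_trans by blast
  with b show ?thesis by simp
qed

lemma mu_le_L: "\<omega> \<in> \<Omega> \<Longrightarrow> \<mu> \<le> L"
  using f_strongly_convex f_smooth by (rule strongly_convex_smooth_le)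

text \<open>The noise is paired with \<open>x - b\<close> rather than with the image of a gradient step, which
  need not be measurable.\<close>

lemma prox_gradient_step:
  assumes \<omega>: "\<omega> \<in> \<Omega>" and eq: "is_equilibrium (f t \<omega>) (r t \<omega>) b"
    and \<eta>: "0 < \<eta>" "\<eta> * L \<le> 1 / 2"
    and p: "p = prox \<eta> (r t \<omega>) (x - \<eta> *\<^sub>R g)"
    and z: "z = gradient (f t \<omega> x) x - g"
  shows "(1 + \<eta> * (\<mu> - \<gamma>)) * (norm (p - b))\<^sup>2
           \<le> (1 - \<eta> * (\<mu> - \<gamma>)) * (norm (x - b))\<^sup>2 + 2 * \<eta> * (z \<bullet> (x - b)) + 2 * \<eta>\<^sup>2 * (norm z)\<^sup>2"
proof -
  let ?r = "r t \<omega>" and ?h = "f t \<omega> b" and ?y = "x - \<eta> *\<^sub>R g"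
  let ?N = "\<lambda>v::'a. (norm v)\<^sup>2"
  note sc = f_strongly_convex[OF \<omega>] and sm = f_smooth[OF \<omega>]
    and r = r_proper_closed_convex[OF \<omega>, of t]
  have diff: "?h differentiable (at u)" for u using sm by (simp add: smooth_function_def)
  have conv: "convex (ereal_epigraph ?r)" using r by (simp add: proper_closed_convex_def)
  obtain s where s: "?r b = ereal s" using equilibrium_finite[OF eq r] .
  \<comment> \<open>With the decision frozen at \<open>b\<close>, the equilibrium is an ordinary
    minimizer; its subgradient inequality also supplies the affine minorant for
    \<open>prox\<close>.\<close>
  have sub_b: "ereal (s - gradient ?h b \<bullet> (u - b)) \<le> ?r u" for u
    using eq
    by (intro arg_min_subgradient[OF conv s _ differentiable_imp_GDERIV_gradient[OF diff]])
      (simp add: is_equilibrium_def is_arg_min_linorder add.commute)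
  have prox_min: "?r p + ereal (1 / (2 * \<eta>) * ?N (p - ?y)) \<le> ?r u + ereal (1 / (2 * \<eta>) * ?N (u - ?y))" for u
    unfolding p by (rule prox_is_minimizer[OF r \<eta>(1) s, of "- gradient ?h b"]) (use sub_b in simp)
  have "?r p \<noteq> \<infinity>" using prox_min[of b] s by auto
  moreover have "?r p \<noteq> -\<infinity>" using r by (simp add: proper_closed_convex_def)
  ultimately obtain q where q: "?r p = ereal q" by (cases "?r p") auto
  have "((\<lambda>u. 1 / (2 * \<eta>) * ?N (u - ?y)) has_derivative
      (\<lambda>v. 1 / (2 * \<eta>) * (2 * ((p - ?y) \<bullet> v)))) (at p)"
    using \<eta>(1) unfolding power2_norm_eq_inner
    by (auto intro!: derivative_eq_intros simp: inner_commute)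
  then have "GDERIV (\<lambda>u. 1 / (2 * \<eta>) * ?N (u - ?y)) p :> (1 / \<eta>) *\<^sub>R (p - ?y)"
    by (simp add: gderiv_def inner_commute)
  from arg_min_subgradient[OF conv q prox_min this, of b]
  have "q - 1 / \<eta> * ((p - ?y) \<bullet> (b - p)) \<le> s" by (simp add: s)
  moreover have "s - gradient ?h b \<bullet> (p - b) \<le> q" using sub_b[of p] by (simp add: q)
  \<comment> \<open>Adding the two subgradient inequalities cancels \<open>q\<close> and
    \<open>s\<close>: monotonicity of the subdifferential of \<open>r\<close>.\<close>
  ultimately have "- (1 / \<eta>) * ((p - ?y) \<bullet> (b - p)) \<le> gradient ?h b \<bullet> (p - b)" by simp
  then have mono: "(p - ?y) \<bullet> (p - b) \<le> \<eta> * (gradient ?h b \<bullet> (p - b))"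
    using \<eta>(1) by (simp add: field_simps inner_diff_right)
  have three_point: "2 * ((x - p) \<bullet> (p - b)) = ?N (x - b) - ?N (p - b) - ?N (x - p)"
    unfolding power2_norm_eq_inner by (simp add: inner_diff_left inner_diff_right inner_commute)
  \<comment> \<open>Descent from \<open>x\<close> to \<open>p\<close> and strong convexity from
    \<open>x\<close> to \<open>b\<close> and from \<open>b\<close> to \<open>p\<close> are summed,
    so that all function values cancel.\<close>
  have curvature: "(gradient ?h x - gradient ?h b) \<bullet> (p - b)
      \<ge> \<mu> / 2 * (?N (x - b) + ?N (p - b)) - L / 2 * ?N (x - p)"
    using smooth_function_descent[OF sm, of t b p x]
      strongly_convex_gradient_ineq[OF sc diff, of x b]
      strongly_convex_gradient_ineq[OF sc diff, of b p]
    by (simp add: norm_minus_commute algebra_simps)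
  \<comment> \<open>The decision shift is split evenly over the two squared distances, so
    \<open>\<mu>\<close> drops to \<open>\<mu> - \<gamma>\<close> in front of both.\<close>
  have shift: "(gradient (f t \<omega> x) x - gradient ?h x) \<bullet> (p - b)
      \<ge> - (\<gamma> / 2) * (?N (x - b) + ?N (p - b))"
  proof -
    have "- ((gradient (f t \<omega> x) x - gradient ?h x) \<bullet> (p - b))
        \<le> norm (gradient (f t \<omega> x) x - gradient ?h x) * norm (p - b)"
      using Cauchy_Schwarz_ineq2[of "gradient (f t \<omega> x) x - gradient ?h x" "p - b"] by linarith
    also have "\<dots> \<le> \<gamma> * norm (x - b) * norm (p - b)"
      by (intro mult_right_mono shift_lipschitz \<omega>) simp
    also have "\<dots> = \<gamma> / 2 * (2 * norm (x - b) * norm (p - b))" by simp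
    also have "\<dots> \<le> \<gamma> / 2 * (?N (x - b) + ?N (p - b))"
      using gamma_nonneg[OF \<omega>] sum_squares_bound by (intro mult_left_mono) auto
    finally show ?thesis by simp
  qed
  \<comment> \<open>Three-point identity and curvature leave \<open>1 - \<eta> * L\<close>, at least
    1/2, times the squared step length to absorb \<open>z \<bullet> (p - x)\<close>.\<close>
  have noise: "2 * \<eta> * (z \<bullet> (p - x)) \<le> (1 - \<eta> * L) * ?N (x - p) + 2 * \<eta>\<^sup>2 * ?N z"
  proof -
    have "0 \<le> ?N ((1 / 2) *\<^sub>R (p - x) - \<eta> *\<^sub>R z)" by simp
    then have "2 * \<eta> * (z \<bullet> (p - x)) \<le> 1 / 2 * ?N (x - p) + 2 * \<eta>\<^sup>2 * ?N z"
      unfolding power2_norm_eq_inner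
      by (simp add: inner_diff_left inner_diff_right inner_commute power2_eq_square algebra_simps)
    also have "1 / 2 * ?N (x - p) \<le> (1 - \<eta> * L) * ?N (x - p)"
      using \<eta>(2) by (intro mult_right_mono) auto
    finally show ?thesis by simp
  qed
  have "(x - p) \<bullet> (p - b) \<ge> \<eta> * ((g - gradient ?h b) \<bullet> (p - b))"
    using mono by (simp add: inner_diff_left inner_diff_right algebra_simps)
  moreover have "g - gradient ?h b = (gradient (f t \<omega> x) x - gradient ?h x)
      + (gradient ?h x - gradient ?h b) - z"
    by (simp add: z)
  ultimately have "(x - p) \<bullet> (p - b) \<ge> \<eta> * ((gradient (f t \<omega> x) x - gradient ?h x) \<bullet> (p - b)
      + (gradient ?h x - gradient ?h b) \<bullet> (p - b) - z \<bullet> (p - b))"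
    by (simp only: inner_diff_left inner_add_left)
  moreover have "\<eta> * ((gradient (f t \<omega> x) x - gradient ?h x) \<bullet> (p - b)
      + (gradient ?h x - gradient ?h b) \<bullet> (p - b) - z \<bullet> (p - b))
      \<ge> \<eta> * (- (\<gamma> / 2) * (?N (x - b) + ?N (p - b))
      + (\<mu> / 2 * (?N (x - b) + ?N (p - b)) - L / 2 * ?N (x - p)) - z \<bullet> (p - b))"
    using shift curvature \<eta>(1) by (intro mult_left_mono) auto
  moreover have "z \<bullet> (p - b) = z \<bullet> (p - x) + z \<bullet> (x - b)"
    by (simp add: inner_diff_right)
  ultimately show ?thesis
    using three_point noise by (simp add: algebra_simps)
qed

end

section \<open>Expected error of one step\<close>

text \<open>Coordinatewise, the \<open>G\<close>-measurable factor \<open>y\<close> is pulled out of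
  the conditional expectation of \<open>z\<close>; square integrability makes the products
  integrable.\<close>

lemma cond_mean_zero_inner:
  fixes y z :: "'w \<Rightarrow> 'a::euclidean_space"
  assumes "prob_space M" and sub: "subalgebra M G" and zero: "cond_mean_zero M G z"
    and y: "y \<in> borel_measurable G"
    and int_y: "integrable M (\<lambda>\<omega>. (norm (y \<omega>))\<^sup>2)" and int_z: "integrable M (\<lambda>\<omega>. (norm (z \<omega>))\<^sup>2)"
  shows "integrable M (\<lambda>\<omega>. z \<omega> \<bullet> y \<omega>)" and "(\<integral>\<omega>. z \<omega> \<bullet> y \<omega> \<partial>M) = 0"
proof -
  interpret prob_space M by fact
  interpret finite_measure_subalgebra M G by unfold_locales (rule sub)
  have [measurable]: "y \<in> borel_measurable M" using sub y by (rule measurable_from_subalg)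
  have [measurable]: "z \<in> borel_measurable M" using zero by (auto simp: cond_mean_zero_def)
  have int: "integrable M (\<lambda>\<omega>. (y \<omega> \<bullet> b) * (z \<omega> \<bullet> b))" if b: "b \<in> Basis" for b
  proof (rule Bochner_Integration.integrable_bound)
    show "integrable M (\<lambda>\<omega>. (norm (y \<omega>))\<^sup>2 + (norm (z \<omega>))\<^sup>2)" using int_y int_z by simp
    have "\<bar>(v \<bullet> b) * (w \<bullet> b)\<bar> \<le> (norm v)\<^sup>2 + (norm w)\<^sup>2" for v w :: 'a
    proof -
      have "\<bar>(v \<bullet> b) * (w \<bullet> b)\<bar> \<le> norm v * norm w"
        unfolding abs_mult by (intro mult_mono Basis_le_norm b) auto
      also have "\<dots> \<le> (norm v)\<^sup>2 + (norm w)\<^sup>2"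
        using sum_squares_bound[of "norm v" "norm w"] mult_nonneg_nonneg[OF norm_ge_zero norm_ge_zero, of v w]
        by linarith
      finally show ?thesis .
    qed
    then show "AE \<omega> in M. norm ((y \<omega> \<bullet> b) * (z \<omega> \<bullet> b)) \<le> norm ((norm (y \<omega>))\<^sup>2 + (norm (z \<omega>))\<^sup>2)"
      by simp
  qed measurable
  have vanish: "(\<integral>\<omega>. (y \<omega> \<bullet> b) * (z \<omega> \<bullet> b) \<partial>M) = 0" if b: "b \<in> Basis" for b
  proof -
    have "(\<integral>\<omega>. (y \<omega> \<bullet> b) * (z \<omega> \<bullet> b) \<partial>M)
        = (\<integral>\<omega>. (y \<omega> \<bullet> b) * real_cond_exp M G (\<lambda>\<omega>. z \<omega> \<bullet> b) \<omega> \<partial>M)"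
      using int[OF b] y by (intro real_cond_exp_intg(2)[symmetric]) auto
    also have "\<dots> = 0"
      using zero b by (intro integral_eq_zero_AE) (auto simp: cond_mean_zero_def)
    finally show ?thesis .
  qed
  have expand: "z \<omega> \<bullet> y \<omega> = (\<Sum>b\<in>Basis. (y \<omega> \<bullet> b) * (z \<omega> \<bullet> b))" for \<omega>
    by (subst euclidean_inner) (simp add: mult.commute)
  show "integrable M (\<lambda>\<omega>. z \<omega> \<bullet> y \<omega>)" unfolding expand using int by simp
  show "(\<integral>\<omega>. z \<omega> \<bullet> y \<omega> \<partial>M) = 0"
    unfolding expand using int vanish by (simp add: Bochner_Integration.integral_sum)
qed

lemma norm_add_squared_le:
  fixes u v :: "'a::real_inner"
  assumes "0 < a"
  shows "(norm (u + v))\<^sup>2 \<le> (1 + a) * (norm u)\<^sup>2 + (1 + 1 / a) * (norm v)\<^sup>2"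
proof -
  have "0 \<le> (norm (a *\<^sub>R u - v))\<^sup>2 / a" using assms by simp
  also have "\<dots> = a * (norm u)\<^sup>2 + (norm v)\<^sup>2 / a - 2 * (u \<bullet> v)"
    using assms unfolding power2_norm_eq_inner
    by (simp add: inner_diff_left inner_diff_right inner_commute field_simps)
  finally show ?thesis
    unfolding power2_norm_eq_inner
    by (simp add: inner_add_left inner_add_right inner_commute algebra_simps)
qed

text \<open>Young's inequality with weight \<open>\<eta> * m\<close> moves the reference from
  \<open>xbar t\<close> to \<open>xbar (Suc t)\<close>, and its factor \<open>1 + \<eta> * m\<close>
  is the one on the left of \<open>step\<close>. Adaptedness of \<open>x t - xbar t\<close> removes
  the noise inner product in expectation.\<close>

lemma (in stochastic_framework) expected_tracking_step:
  assumes \<eta>: "0 < \<eta>" and m: "0 < m" "\<eta> * m \<le> 1 / 2"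
    and int: "integrable M (\<lambda>\<omega>. (norm (x t \<omega> - xbar t \<omega>))\<^sup>2)"
    and drift: "integrable M (\<lambda>\<omega>. (norm (xbar t \<omega> - xbar (Suc t) \<omega>))\<^sup>2)"
      "(\<integral>\<omega>. (norm (xbar t \<omega> - xbar (Suc t) \<omega>))\<^sup>2 \<partial>M) \<le> \<Delta>\<^sup>2"
    and noise: "integrable M (\<lambda>\<omega>. (norm (z t \<omega>))\<^sup>2)" "(\<integral>\<omega>. (norm (z t \<omega>))\<^sup>2 \<partial>M) \<le> \<sigma>\<^sup>2"
    and step: "\<And>\<omega>. \<omega> \<in> space M \<Longrightarrow> (1 + \<eta> * m) * (norm (x (Suc t) \<omega> - xbar t \<omega>))\<^sup>2
        \<le> (1 - \<eta> * m) * (norm (x t \<omega> - xbar t \<omega>))\<^sup>2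
          + 2 * \<eta> * (z t \<omega> \<bullet> (x t \<omega> - xbar t \<omega>)) + 2 * \<eta>\<^sup>2 * (norm (z t \<omega>))\<^sup>2"
  shows "integrable M (\<lambda>\<omega>. (norm (x (Suc t) \<omega> - xbar (Suc t) \<omega>))\<^sup>2)"
    and "(\<integral>\<omega>. (norm (x (Suc t) \<omega> - xbar (Suc t) \<omega>))\<^sup>2 \<partial>M)
      \<le> (1 - \<eta> * m) * (\<integral>\<omega>. (norm (x t \<omega> - xbar t \<omega>))\<^sup>2 \<partial>M)
        + 2 * \<eta>\<^sup>2 * \<sigma>\<^sup>2 + 3 / (2 * (\<eta> * m)) * \<Delta>\<^sup>2"
proof -
  define a where "a = \<eta> * m"
  have a: "0 < a" "a \<le> 1 / 2" using \<eta> m by (simp_all add: a_def)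
  let ?B = "\<lambda>\<omega>. (1 - a) * (norm (x t \<omega> - xbar t \<omega>))\<^sup>2
          + 2 * \<eta> * (z t \<omega> \<bullet> (x t \<omega> - xbar t \<omega>)) + 2 * \<eta>\<^sup>2 * (norm (z t \<omega>))\<^sup>2
          + 3 / (2 * a) * (norm (xbar t \<omega> - xbar (Suc t) \<omega>))\<^sup>2"
  have [measurable]: "x s \<in> borel_measurable M" "xbar s \<in> borel_measurable M" for s
    using measurable_from_subalg[OF F_subalgebra] x_measurable xbar_measurable by blast+
  have bound: "(norm (x (Suc t) \<omega> - xbar (Suc t) \<omega>))\<^sup>2 \<le> ?B \<omega>" if \<omega>: "\<omega> \<in> space M" for \<omega>
  proof -
    have "(norm (x (Suc t) \<omega> - xbar (Suc t) \<omega>))\<^sup>2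
        \<le> (1 + a) * (norm (x (Suc t) \<omega> - xbar t \<omega>))\<^sup>2
          + (1 + 1 / a) * (norm (xbar t \<omega> - xbar (Suc t) \<omega>))\<^sup>2"
      using norm_add_squared_le[OF a(1), of "x (Suc t) \<omega> - xbar t \<omega>" "xbar t \<omega> - xbar (Suc t) \<omega>"]
      by simp
    moreover have "(1 + 1 / a) * (norm (xbar t \<omega> - xbar (Suc t) \<omega>))\<^sup>2
        \<le> 3 / (2 * a) * (norm (xbar t \<omega> - xbar (Suc t) \<omega>))\<^sup>2"
      using a by (intro mult_right_mono) (simp_all add: field_simps)
    ultimately show ?thesis using step[OF \<omega>] unfolding a_def by linarith
  qed
  have "(\<lambda>\<omega>. x t \<omega> - xbar t \<omega>) \<in> borel_measurable (F t)"
    using x_measurable xbar_measurable by (intro borel_measurable_diff)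
  note cross = cond_mean_zero_inner[OF prob_space_axioms F_subalgebra z_cond_mean_zero this int noise(1)]
  have int_B: "integrable M ?B" using int cross(1) noise(1) drift(1) by simp
  \<comment> \<open>Domination by \<open>?B\<close> passes integrability on to the next time, so the
    iteration can carry it along.\<close>
  show int': "integrable M (\<lambda>\<omega>. (norm (x (Suc t) \<omega> - xbar (Suc t) \<omega>))\<^sup>2)"
  proof (rule Bochner_Integration.integrable_bound[OF int_B])
    show "AE \<omega> in M. norm ((norm (x (Suc t) \<omega> - xbar (Suc t) \<omega>))\<^sup>2) \<le> norm (?B \<omega>)"
    proof (rule AE_I2)
      fix \<omega> assume "\<omega> \<in> space M"
      from order_trans[OF bound[OF this] abs_ge_self]
      show "norm ((norm (x (Suc t) \<omega> - xbar (Suc t) \<omega>))\<^sup>2) \<le> norm (?B \<omega>)" by simp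
    qed
  qed measurable
  have "(\<integral>\<omega>. (norm (x (Suc t) \<omega> - xbar (Suc t) \<omega>))\<^sup>2 \<partial>M) \<le> (\<integral>\<omega>. ?B \<omega> \<partial>M)"
    using int' int_B bound by (rule integral_mono)
  also have "\<dots> = (1 - a) * (\<integral>\<omega>. (norm (x t \<omega> - xbar t \<omega>))\<^sup>2 \<partial>M)
      + 2 * \<eta>\<^sup>2 * (\<integral>\<omega>. (norm (z t \<omega>))\<^sup>2 \<partial>M)
      + 3 / (2 * a) * (\<integral>\<omega>. (norm (xbar t \<omega> - xbar (Suc t) \<omega>))\<^sup>2 \<partial>M)"
    using int cross noise(1) drift(1) by simp
  also have "\<dots> \<le> (1 - a) * (\<integral>\<omega>. (norm (x t \<omega> - xbar t \<omega>))\<^sup>2 \<partial>M)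
      + 2 * \<eta>\<^sup>2 * \<sigma>\<^sup>2 + 3 / (2 * a) * \<Delta>\<^sup>2"
    using noise(2) drift(2) a by (intro add_mono mult_left_mono) auto
  finally show "(\<integral>\<omega>. (norm (x (Suc t) \<omega> - xbar (Suc t) \<omega>))\<^sup>2 \<partial>M)
      \<le> (1 - \<eta> * m) * (\<integral>\<omega>. (norm (x t \<omega> - xbar t \<omega>))\<^sup>2 \<partial>M)
        + 2 * \<eta>\<^sup>2 * \<sigma>\<^sup>2 + 3 / (2 * (\<eta> * m)) * \<Delta>\<^sup>2"
    by (simp add: a_def)
qed

text \<open>\<open>v\<close> is the fixed point of the recursion, so only the excess over it must
  decay. \<open>P\<close> carries integrability, without which no step bound is available.\<close>

lemma contraction_iterate:
  fixes E :: "nat \<Rightarrow> real"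
  assumes step: "\<And>t. s \<le> t \<Longrightarrow> t < s + n \<Longrightarrow> P t \<Longrightarrow> P (Suc t) \<and> E (Suc t) \<le> (1 - a) * E t + a * v"
    and "P s" "0 \<le> E s" "0 \<le> v" "0 \<le> a" "a \<le> 1"
  shows "P (s + n) \<and> E (s + n) \<le> exp (- a * real n) * E s + v"
proof -
  have "P (s + j) \<and> E (s + j) \<le> (1 - a) ^ j * E s + v" if "j \<le> n" for j
    using that
  proof (induction j)
    case (Suc j)
    then have "P (Suc (s + j))" and le: "E (Suc (s + j)) \<le> (1 - a) * E (s + j) + a * v"
      using step[of "s + j"] by auto
    moreover have "(1 - a) * E (s + j) \<le> (1 - a) * ((1 - a) ^ j * E s + v)"
      using Suc assms by (intro mult_left_mono) auto
    ultimately show ?case by (simp add: algebra_simps)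
  qed (use assms in simp)
  then have "P (s + n)" "E (s + n) \<le> (1 - a) ^ n * E s + v" by auto
  moreover have "(1 - a) ^ n * E s \<le> exp (- a * real n) * E s"
  proof -
    have "(1 - a) ^ n \<le> exp (- a) ^ n"
      using assms exp_ge_add_one_self[of "- a"] by (intro power_mono) auto
    also have "\<dots> = exp (- a * real n)" by (simp add: exp_of_nat_mult[symmetric] mult.commute)
    finally show ?thesis using assms by (intro mult_right_mono) auto
  qed
  ultimately show ?thesis by linarith
qed

section \<open>The step decay schedule\<close>

lemma powr_third_cubed: "0 < a \<Longrightarrow> (a powr (1 / 3)) ^ 3 = (a::real)"
  by (simp add: powr_power)

lemma powr_two_thirds_cubed: "0 < a \<Longrightarrow> (a powr (2 / 3)) ^ 3 = (a::real)\<^sup>2"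
  by (simp add: powr_power)

lemma eq_of_cube_eq: "a ^ 3 = b ^ 3 \<Longrightarrow> 0 \<le> a \<Longrightarrow> 0 \<le> b \<Longrightarrow> a = (b::real)"
  by (rule power_eq_imp_eq_base) auto

text \<open>The deterministic half of the argument, with \<open>m\<close> for
  \<open>\<mu> - \<gamma>\<close> and \<open>es\<close> for the limiting step size.\<close>

locale step_schedule =
  fixes m L \<Delta> \<sigma> es Err :: real and \<eta> :: "nat \<Rightarrow> real" and T :: "nat \<Rightarrow> nat" and K :: nat
  assumes m_pos: "0 < m" and L_pos: "0 < L" and m_le_L: "m \<le> L"
    and Delta_pos: "0 < \<Delta>" and sigma_pos: "0 < \<sigma>"
    and low_drift: "\<Delta> / \<sigma> < sqrt (m / (16 * L ^ 3))"
    and es: "es = (2 * \<Delta>\<^sup>2 / (m * \<sigma>\<^sup>2)) powr (1/3)"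
    and Err: "Err = (\<Delta> * \<sigma>\<^sup>2 / m\<^sup>2) powr (2/3)"
    and K: "K = nat (1 + \<lceil>log 2 (1 / L * (\<sigma>\<^sup>2 * m / \<Delta>\<^sup>2) powr (1/3))\<rceil>)"
    and eta_0: "\<eta> 0 = 1 / (2 * L)"
    and eta_Suc: "\<And>k. k \<ge> 1 \<Longrightarrow> \<eta> k = (\<eta> (k - 1) + es) / 2"
    and T_Suc: "\<And>k. k \<ge> 1 \<Longrightarrow> T k = nat \<lceil>ln 4 / (m * \<eta> k)\<rceil>"
begin

text \<open>The factor 2 sits under the cube root in \<open>es\<close> but is absent from
  \<open>Err\<close>; \<open>c\<close> is the resulting discrepancy.\<close>

definition c :: real where "c = 2 powr (1 / 3)"

lemma c_cubed: "c ^ 3 = 2" by (simp add: c_def powr_third_cubed)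

lemma c_gt_1: "1 < c" by (simp add: c_def)

lemma c_less: "c < 4 / 3"
proof (rule ccontr)
  assume "\<not> c < 4 / 3"
  then have "(4 / 3) ^ 3 \<le> c ^ 3" by (intro power_mono) auto
  then show False unfolding c_cubed by (simp add: power3_eq_cube)
qed

lemma es_pos: "0 < es"
  using m_pos Delta_pos sigma_pos by (simp add: es)

lemma es_cubed: "es ^ 3 = 2 * \<Delta>\<^sup>2 / (m * \<sigma>\<^sup>2)"
  unfolding es using m_pos Delta_pos sigma_pos by (intro powr_third_cubed) simp

lemma Delta_squared: "\<Delta>\<^sup>2 = es ^ 3 * m * \<sigma>\<^sup>2 / 2"
  unfolding es_cubed using m_pos sigma_pos by simp

text \<open>Squaring the low-drift condition and multiplying by \<open>2 / m\<close> gives the cubed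
  claim, as \<open>(\<eta> 0) ^ 3 = 1 / (8 * L ^ 3)\<close>. Hence the step sizes decrease to
  \<open>es\<close> from above.\<close>

lemma es_less: "es < \<eta> 0"
proof -
  have "(\<Delta> / \<sigma>)\<^sup>2 < (sqrt (m / (16 * L ^ 3)))\<^sup>2"
    using low_drift Delta_pos sigma_pos by (intro power_strict_mono) auto
  then have "\<Delta>\<^sup>2 / \<sigma>\<^sup>2 < m / (16 * L ^ 3)"
    using m_pos L_pos by (simp add: power_divide)
  then have "2 / m * (\<Delta>\<^sup>2 / \<sigma>\<^sup>2) < 2 / m * (m / (16 * L ^ 3))"
    using m_pos by (intro mult_strict_left_mono) auto
  also have "\<dots> = (\<eta> 0) ^ 3"
    using m_pos by (simp add: eta_0 power_divide power_mult_distrib)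
  finally have "es ^ 3 < (\<eta> 0) ^ 3" by (simp add: es_cubed)
  then show ?thesis
    by (rule power_less_imp_less_base) (simp add: eta_0 L_pos less_imp_le)
qed

text \<open>Up to \<open>c\<close>, the target error is the noise level at the limiting step size.
  Comparing cubes removes the fractional powers.\<close>

lemma Err_eq: "Err = es * \<sigma>\<^sup>2 / (m * c)"
proof (rule eq_of_cube_eq)
  have "0 < \<Delta> * \<sigma>\<^sup>2 / m\<^sup>2" using m_pos Delta_pos sigma_pos by simp
  then have "Err ^ 3 = (\<Delta> * \<sigma>\<^sup>2 / m\<^sup>2) ^ 2"
    unfolding Err by (rule powr_two_thirds_cubed)
  also have "\<dots> = es ^ 3 * \<sigma> ^ 6 / (m ^ 3 * c ^ 3)"
    unfolding es_cubed c_cubed using m_pos sigma_pos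
    by (simp add: power_mult_distrib power_divide field_simps flip: power_add power_mult)
      (simp add: field_simps eval_nat_numeral)
  also have "\<dots> = (es * \<sigma>\<^sup>2 / (m * c)) ^ 3"
    by (simp add: power_mult_distrib power_divide flip: power_mult)
  finally show "Err ^ 3 = (es * \<sigma>\<^sup>2 / (m * c)) ^ 3" .
qed (use es_pos m_pos c_gt_1 in \<open>simp_all add: Err\<close>)

lemma Err_pos: "0 < Err"
  using es_pos m_pos sigma_pos c_gt_1 by (simp add: Err_eq)

lemma variance_ratio_eq: "\<sigma>\<^sup>2 / (m\<^sup>2 * Err) = c / (m * es)"
  using es_pos m_pos sigma_pos c_gt_1 by (simp add: Err_eq field_simps power2_eq_square)

lemma eta_eq: "\<eta> k = es + (\<eta> 0 - es) / 2 ^ k"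
proof (induction k)
  case (Suc k)
  then have "\<eta> (Suc k) = (es + (\<eta> 0 - es) / 2 ^ k + es) / 2" using eta_Suc[of "Suc k"] by simp
  then show ?case by (simp add: field_simps)
qed simp

lemma eta_gt_es: "es < \<eta> k"
  using es_less by (simp add: eta_eq[of k])

lemma eta_pos: "0 < \<eta> k"
  using eta_gt_es es_pos by (rule less_trans[rotated])

lemma eta_le: "\<eta> k \<le> 1 / (2 * L)"
proof -
  have "(\<eta> 0 - es) / 2 ^ k \<le> (\<eta> 0 - es) / 1"
    using es_less by (intro divide_left_mono) auto
  then show ?thesis by (simp add: eta_eq[of k] eta_0[symmetric])
qed

lemma eta_m_le: "\<eta> k * m \<le> 1 / 2"
proof -
  have "\<eta> k * m \<le> 1 / (2 * L) * L"
    using eta_le m_le_L m_pos L_pos by (intro mult_mono) auto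
  then show ?thesis using L_pos by simp
qed

lemma eta_ge: "\<eta> 0 / 2 ^ k \<le> \<eta> k"
proof -
  have "es / 2 ^ k \<le> es / 1" using es_pos by (intro divide_left_mono) auto
  then show ?thesis by (simp add: eta_eq[of k] diff_divide_distrib)
qed

text \<open>The lower bound on \<open>2 ^ n\<close> brings the last step size within a constant
  factor of \<open>es\<close>; the upper bound controls the geometric sum of epoch lengths.\<close>

lemma num_epochs:
  obtains n where "K = Suc n" "c / (L * es) \<le> 2 ^ n" "2 ^ n \<le> 2 * c / (L * es)"
proof -
  define q where "q = c / (L * es)"
  define n where "n = nat \<lceil>log 2 q\<rceil>"
  have "(\<sigma>\<^sup>2 * m / \<Delta>\<^sup>2) powr (1/3) = c / es"
  proof (rule eq_of_cube_eq)
    show "((\<sigma>\<^sup>2 * m / \<Delta>\<^sup>2) powr (1/3)) ^ 3 = (c / es) ^ 3"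
      using m_pos sigma_pos Delta_pos
      by (simp add: powr_third_cubed power_divide c_cubed es_cubed field_simps)
  qed (use es_pos c_gt_1 in simp_all)
  then have K': "K = nat (1 + \<lceil>log 2 q\<rceil>)" by (simp add: K q_def)
  \<comment> \<open>So the logarithm is positive and truncation by \<open>nat\<close> loses
    nothing.\<close>
  have "1 < q" using es_less es_pos c_gt_1 L_pos by (simp add: q_def eta_0 field_simps)
  then have q: "0 < q" "0 < log 2 q" by auto
  then have n: "log 2 q \<le> real n" "real n \<le> log 2 q + 1"
    unfolding n_def by linarith+
  have "q = 2 powr log 2 q" using q by simp
  also have "\<dots> \<le> 2 powr real n" using n by (intro powr_mono) auto
  finally have lower: "q \<le> 2 ^ n" by (simp add: powr_realpow)
  have "2 ^ n = 2 powr real n" by (simp add: powr_realpow)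
  also have "\<dots> \<le> 2 powr (log 2 q + 1)" using n by (intro powr_mono) auto
  also have "\<dots> = 2 * q" using q by (simp add: powr_add)
  finally have upper: "2 ^ n \<le> 2 * q" .
  have "K = Suc n" using q(2) unfolding K' n_def by linarith
  then show thesis using that[of n] lower upper by (simp add: q_def)
qed

section \<open>Epoch lengths and the time horizon\<close>

lemma epoch_length_le: "real (T (Suc k)) \<le> 8 * L * 2 ^ k / m"
proof -
  define e where "e = m * \<eta> (Suc k)"
  have e: "0 < e" "e \<le> 1 / 2"
    using m_pos eta_pos eta_m_le[of "Suc k"] by (simp_all add: e_def mult.commute)
  have ln4: "ln (4::real) \<le> 25 / 18"
    using ln_mult[of 2 "2::real"] ln2_le_25_over_36 by simp
  have "real (T (Suc k)) \<le> ln 4 / e + 1"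
    using e by (simp add: T_Suc e_def[symmetric])
  \<comment> \<open>As \<open>e\<close> is at most 1/2, the 1 lost by rounding up is at most
    \<open>(1 / 2) / e\<close>; and 25/18 + 1/2 < 2.\<close>
  also have "\<dots> \<le> (25 / 18) / e + (1 / 2) / e"
    using e ln4 by (intro add_mono divide_right_mono) (auto simp: field_simps)
  also have "\<dots> \<le> 2 / e" using e by (simp add: field_simps)
  also have "\<dots> \<le> 2 / (m * (\<eta> 0 / 2 ^ Suc k))"
    unfolding e_def using m_pos eta_ge[of "Suc k"] eta_pos[of 0] eta_pos[of "Suc k"]
    by (intro divide_left_mono mult_left_mono) auto
  also have "\<dots> = 8 * L * 2 ^ k / m" by (simp add: eta_0)
  finally show ?thesis .
qed

lemma horizon_le:
  assumes l: "0 \<le> l" and T_0: "T 0 = nat \<lceil>2 * L / m * l\<rceil>"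
  shows "real (\<Sum>k<K. T k) \<le> abs_const * (L / m * l + \<sigma>\<^sup>2 / (m\<^sup>2 * Err))"
proof -
  obtain n where n: "K = Suc n" "2 ^ n \<le> 2 * c / (L * es)" using num_epochs by blast
  have "real (\<Sum>k<K. T k) = real (T 0) + (\<Sum>k<n. real (T (Suc k)))"
    unfolding n(1) by (subst sum.lessThan_Suc_shift) simp
  also have "(\<Sum>k<n. real (T (Suc k))) \<le> (\<Sum>k<n. 8 * L / m * 2 ^ k)"
    using epoch_length_le by (intro sum_mono) (simp add: mult.commute)
  also have "\<dots> = 8 * L / m * (2 ^ n - 1)"
    by (subst sum_distrib_left[symmetric]) (simp add: sum_gp_strict)
  also have "\<dots> \<le> 8 * L / m * (2 * c / (L * es))"
    using n(2) L_pos m_pos by (intro mult_left_mono) auto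
  also have "\<dots> = 16 * (c / (m * es))" using L_pos by simp
  finally have "real (\<Sum>k<K. T k) \<le> real (T 0) + 16 * (c / (m * es))" by simp
  moreover have "real (T 0) \<le> 2 * (L / m * l) + 1"
  proof -
    have "0 \<le> 2 * L / m * l" using l L_pos m_pos by simp
    then have "real (T 0) \<le> 2 * L / m * l + 1" unfolding T_0 by linarith
    then show ?thesis by simp
  qed
  \<comment> \<open>This absorbs the 1 lost by rounding up \<open>T 0\<close>; the logarithmic term
    cannot, since it may vanish.\<close>
  moreover have "1 \<le> c / (m * es)"
  proof -
    have "m * es \<le> m * \<eta> 0" using es_less m_pos by simp
    then have "m * es \<le> c" using eta_m_le[of 0] c_gt_1 by (simp add: mult.commute)
    then show ?thesis using m_pos es_pos by simp
  qed
  moreover have "0 \<le> L / m * l" using l L_pos m_pos by simp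
  moreover have "N \<le> 100 * (A + B)"
    if "N \<le> t + 16 * B" "t \<le> 2 * A + 1" "1 \<le> B" "0 \<le> A" for N t A B :: real
    using that by simp
  ultimately show ?thesis
    unfolding variance_ratio_eq abs_const_def by blast
qed

text \<open>By \<open>Err_eq\<close>, comparing the two arguments of the logarithm amounts to
  \<open>es * L <= c\<close>.\<close>

lemma log_term_le:
  assumes "0 < D"
  shows "L / m * max (ln (m * L * D / \<sigma>\<^sup>2)) 0 \<le> L / m * max (ln (D / Err)) 0"
proof -
  have "es * L \<le> c" using es_less c_gt_1 L_pos by (simp add: eta_0 field_simps)
  then have "es * L * (D * m) \<le> c * (D * m)" using assms m_pos by (intro mult_right_mono) auto
  then have "m * L * D / \<sigma>\<^sup>2 \<le> D / Err"
    using es_pos m_pos sigma_pos c_gt_1 by (simp add: Err_eq field_simps)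
  then have "ln (m * L * D / \<sigma>\<^sup>2) \<le> ln (D / Err)"
    using assms L_pos m_pos sigma_pos by (intro ln_mono) auto
  then show ?thesis using L_pos m_pos by (intro mult_left_mono) auto
qed

section \<open>Error after each epoch\<close>

lemma first_epoch_decay:
  assumes D: "0 < D" and T_0: "T 0 = nat \<lceil>2 * L / m * max (ln (m * L * D / \<sigma>\<^sup>2)) 0\<rceil>"
  shows "exp (- (\<eta> 0 * m) * real (T 0)) * D \<le> 2 * (\<eta> 0 * \<sigma>\<^sup>2 / m)"
proof -
  \<comment> \<open>\<open>T 0\<close> makes \<open>\<eta> 0 * m * T 0\<close> at least
    \<open>ln w\<close>, which reduces \<open>D\<close> to at most \<open>D / w\<close>, twice the
    noise level at \<open>\<eta> 0\<close>.\<close>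
  define w where "w = m * L * D / \<sigma>\<^sup>2"
  have w: "0 < w" using D L_pos m_pos sigma_pos by (simp add: w_def)
  have "2 * L / m * ln w \<le> 2 * L / m * max (ln w) 0"
    using L_pos m_pos by (intro mult_left_mono) auto
  also have "\<dots> \<le> real (T 0)" unfolding T_0 w_def by (rule real_nat_ceiling_ge)
  finally have "m / (2 * L) * (2 * L / m * ln w) \<le> m / (2 * L) * real (T 0)"
    using L_pos m_pos by (intro mult_left_mono) auto
  then have "ln w \<le> \<eta> 0 * m * real (T 0)" using L_pos m_pos by (simp add: eta_0)
  then have "exp (- (\<eta> 0 * m) * real (T 0)) \<le> exp (- ln w)" by simp
  also have "\<dots> = 1 / w" using w by (simp add: exp_minus inverse_eq_divide)
  finally have "exp (- (\<eta> 0 * m) * real (T 0)) * D \<le> 1 / w * D"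
    using D by (intro mult_right_mono) auto
  also have "\<dots> = 2 * (\<eta> 0 * \<sigma>\<^sup>2 / m)" using D L_pos by (simp add: w_def eta_0)
  finally show ?thesis .
qed

lemma later_epoch_decay: "exp (- (\<eta> (Suc k) * m) * real (T (Suc k))) \<le> 1 / 4"
proof -
  have p: "0 < m * \<eta> (Suc k)" using m_pos eta_pos by simp
  have "ln 4 / (m * \<eta> (Suc k)) \<le> real (T (Suc k))"
    using T_Suc[of "Suc k"] real_nat_ceiling_ge by simp
  then have "ln 4 \<le> \<eta> (Suc k) * m * real (T (Suc k))"
    using p by (simp add: pos_divide_le_eq mult.commute mult.left_commute)
  then have "exp (- (\<eta> (Suc k) * m) * real (T (Suc k))) \<le> exp (- ln 4)" by simp
  also have "\<dots> = 1 / 4" by (simp add: exp_minus)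
  finally show ?thesis .
qed

text \<open>With \<open>\<Delta>\<^sup>2 = es\<^sup>3 m \<sigma>\<^sup>2 / 2\<close> and \<open>es < \<eta> k\<close>, the drift contributes at most
  \<open>(3/4) \<eta> k \<sigma>\<^sup>2 / m\<close> to the stationary error, next to \<open>2 \<eta> k \<sigma>\<^sup>2 / m\<close> from the noise.\<close>

lemma stationary_error_le:
  "2 * (\<eta> k)\<^sup>2 * \<sigma>\<^sup>2 + 3 / (2 * (\<eta> k * m)) * \<Delta>\<^sup>2 \<le> \<eta> k * m * (11 / 4 * (\<eta> k * \<sigma>\<^sup>2 / m))"
proof -
  have "es ^ 3 \<le> (\<eta> k) ^ 3" using eta_gt_es[of k] es_pos by (intro power_mono) auto
  then have "3 / (4 * \<eta> k) * \<sigma>\<^sup>2 * es ^ 3 \<le> 3 / (4 * \<eta> k) * \<sigma>\<^sup>2 * (\<eta> k) ^ 3"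
    using eta_pos[of k] by (intro mult_left_mono) auto
  then show ?thesis
    unfolding Delta_squared using eta_pos[of k] m_pos
    by (simp add: power3_eq_cube power2_eq_square)
qed

text \<open>\<open>E\<close> stands for the expected squared error and \<open>P t\<close> for its
  integrability at time \<open>t\<close>.\<close>

lemma epochs_error_le:
  fixes E :: "nat \<Rightarrow> real" and P :: "nat \<Rightarrow> bool"
  assumes D: "0 < D" "E 0 \<le> D"
    and T_0: "T 0 = nat \<lceil>2 * L / m * max (ln (m * L * D / \<sigma>\<^sup>2)) 0\<rceil>"
    and E_nonneg: "\<And>t. 0 \<le> E t" and P_0: "P 0"
    and step: "\<And>k t. k < K \<Longrightarrow> (\<Sum>j<k. T j) \<le> t \<Longrightarrow> t < (\<Sum>j<k. T j) + T k \<Longrightarrow> P t \<Longrightarrow>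
      P (Suc t) \<and> E (Suc t) \<le> (1 - \<eta> k * m) * E t + 2 * (\<eta> k)\<^sup>2 * \<sigma>\<^sup>2 + 3 / (2 * (\<eta> k * m)) * \<Delta>\<^sup>2"
  shows "P (\<Sum>k<K. T k) \<and> E (\<Sum>k<K. T k) \<le> abs_const * Err"
proof -
  define \<tau> where "\<tau> k = (\<Sum>j<k. T j)" for k
  have epoch: "P (\<tau> (Suc k)) \<and> E (\<tau> (Suc k)) \<le> exp (- (\<eta> k * m) * real (T k)) * E (\<tau> k)
      + 11 / 4 * (\<eta> k * \<sigma>\<^sup>2 / m)" if "k < K" "P (\<tau> k)" for k
  proof -
    have "P (\<tau> k + T k) \<and> E (\<tau> k + T k) \<le> exp (- (\<eta> k * m) * real (T k)) * E (\<tau> k)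
        + 11 / 4 * (\<eta> k * \<sigma>\<^sup>2 / m)"
    proof (rule contraction_iterate)
      fix t assume "\<tau> k \<le> t" "t < \<tau> k + T k" "P t"
      then show "P (Suc t) \<and> E (Suc t) \<le> (1 - \<eta> k * m) * E t + \<eta> k * m * (11 / 4 * (\<eta> k * \<sigma>\<^sup>2 / m))"
        using step[of k t] that(1) stationary_error_le[of k] unfolding \<tau>_def by linarith
    qed (use that E_nonneg eta_pos[of k] m_pos eta_m_le[of k] in auto)
    then show ?thesis by (simp add: \<tau>_def)
  qed
  \<comment> \<open>11/2 is twice the stationary level 11/4. Epoch 0 leaves 2 + 11/4, which is less;
    later a quarter of 11/2, doubled because the step size may halve, is 11/4, and adding 11/4
    restores 11/2.\<close>
  have bound: "P (\<tau> (Suc k)) \<and> E (\<tau> (Suc k)) \<le> 11 / 2 * (\<eta> k * \<sigma>\<^sup>2 / m)" if "k < K" for k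
    using that
  proof (induction k)
    case 0
    have "exp (- (\<eta> 0 * m) * real (T 0)) * E (\<tau> 0) \<le> exp (- (\<eta> 0 * m) * real (T 0)) * D"
      using D by (intro mult_left_mono) (auto simp: \<tau>_def)
    moreover have "0 \<le> \<eta> 0 * \<sigma>\<^sup>2 / m" using eta_pos[of 0] m_pos by simp
    moreover have "P (\<tau> 0)" using P_0 by (simp add: \<tau>_def)
    ultimately show ?case
      using epoch[of 0] 0 first_epoch_decay[OF D(1) T_0] by linarith
  next
    case (Suc k)
    then have P: "P (\<tau> (Suc k))" and E: "E (\<tau> (Suc k)) \<le> 11 / 2 * (\<eta> k * \<sigma>\<^sup>2 / m)" by auto
    have "exp (- (\<eta> (Suc k) * m) * real (T (Suc k))) * E (\<tau> (Suc k))
        \<le> 1 / 4 * (11 / 2 * (\<eta> k * \<sigma>\<^sup>2 / m))"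
      using later_epoch_decay E E_nonneg by (intro mult_mono) auto
    moreover have "\<eta> k * \<sigma>\<^sup>2 / m \<le> 2 * (\<eta> (Suc k) * \<sigma>\<^sup>2 / m)"
    proof -
      have "\<eta> k \<le> 2 * \<eta> (Suc k)" using eta_Suc[of "Suc k"] es_pos by simp
      then have "\<eta> k * (\<sigma>\<^sup>2 / m) \<le> 2 * \<eta> (Suc k) * (\<sigma>\<^sup>2 / m)"
        using m_pos by (intro mult_right_mono) auto
      then show ?thesis by simp
    qed
    ultimately show ?case using epoch[OF Suc.prems P] by linarith
  qed
  obtain n where n: "K = Suc n" "c / (L * es) \<le> 2 ^ n" using num_epochs by blast
  \<comment> \<open>The choice of \<open>K\<close> leaves the last step size an excess over
    \<open>es\<close> of at most \<open>es / 2\<close>.\<close>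
  have "(\<eta> 0 - es) / 2 ^ n \<le> \<eta> 0 / (c / (L * es))"
    using n(2) es_pos es_less c_gt_1 L_pos by (intro frac_le) auto
  also have "\<dots> = es / (2 * c)" using L_pos by (simp add: eta_0)
  also have "\<dots> \<le> es / 2" using es_pos c_gt_1 by (simp add: field_simps)
  finally have "\<eta> n \<le> 3 / 2 * es" by (simp add: eta_eq[of n])
  then have "\<eta> n * (\<sigma>\<^sup>2 / m) \<le> 3 / 2 * es * (\<sigma>\<^sup>2 / m)"
    using m_pos by (intro mult_right_mono) auto
  also have "\<dots> = 3 / 2 * c * Err" using c_gt_1 by (simp add: Err_eq)
  \<comment> \<open>Here \<open>c < 4 / 3\<close> enters; the final factor is 11, well below
    \<open>abs_const\<close>.\<close>
  also have "\<dots> \<le> 2 * Err" using c_less Err_pos by (intro mult_right_mono) auto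
  finally have "11 / 2 * (\<eta> n * \<sigma>\<^sup>2 / m) \<le> abs_const * Err"
    using Err_pos by (simp add: abs_const_def)
  then show ?thesis using bound[of n] n(1) unfolding \<tau>_def by auto
qed

end

section \<open>From the schedule to the tracking bound\<close>

theorem theorem28:
  fixes M :: "'w measure" and F :: "nat \<Rightarrow> 'w measure"
    and f :: "nat \<Rightarrow> 'w \<Rightarrow> 'a::euclidean_space \<Rightarrow> 'a \<Rightarrow> real"
    and r :: "nat \<Rightarrow> 'w \<Rightarrow> 'a \<Rightarrow> ereal"
    and x xbar g X :: "nat \<Rightarrow> 'w \<Rightarrow> 'a"
    and \<mu> L \<gamma> mubar \<Delta> \<sigma> D eta_star Err :: real
    and \<eta> :: "nat \<Rightarrow> real" and T \<tau> :: "nat \<Rightarrow> nat" and K Ttot :: nat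
  assumes problem: "decision_dependent_problem (space M) f r \<mu> L \<gamma>"
    and mubar: "mubar = \<mu> - \<gamma>"
    and equilibrium: "\<And>t \<omega>. \<omega> \<in> space M \<Longrightarrow> is_equilibrium (f t \<omega>) (r t \<omega>) (xbar t \<omega>)"
    and framework: "stochastic_framework M F x xbar (gradient_noise f x g)"
    and Delta_pos: "\<Delta> > 0" and sigma_pos: "\<sigma> > 0"
    and drift: "\<And>t. integrable M (\<lambda>\<omega>. (norm (xbar t \<omega> - xbar (Suc t) \<omega>))\<^sup>2) \<and>
          (\<integral>\<omega>. (norm (xbar t \<omega> - xbar (Suc t) \<omega>))\<^sup>2 \<partial>M) \<le> \<Delta>\<^sup>2"
    and noise: "\<And>t. integrable M (\<lambda>\<omega>. (norm (gradient_noise f x g t \<omega>))\<^sup>2) \<and>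
          (\<integral>\<omega>. (norm (gradient_noise f x g t \<omega>))\<^sup>2 \<partial>M) \<le> \<sigma>\<^sup>2"
    and low_drift: "\<Delta> / \<sigma> < sqrt (mubar / (16 * L ^ 3))"
    and eta_star: "eta_star = (2 * \<Delta>\<^sup>2 / (mubar * \<sigma>\<^sup>2)) powr (1/3)"
    and Err: "Err = (\<Delta> * \<sigma>\<^sup>2 / mubar\<^sup>2) powr (2/3)"
    and D_pos: "D > 0"
    and D: "\<And>\<omega>. \<omega> \<in> space M \<Longrightarrow> (norm (x 0 \<omega> - xbar 0 \<omega>))\<^sup>2 \<le> D"
    and K: "K = nat (1 + \<lceil>log 2 (1 / L * (\<sigma>\<^sup>2 * mubar / \<Delta>\<^sup>2) powr (1/3))\<rceil>)"
    and eta_0: "\<eta> 0 = 1 / (2 * L)"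
    and T_0: "T 0 = nat \<lceil>2 * L / mubar * max (ln (mubar * L * D / \<sigma>\<^sup>2)) 0\<rceil>"
    and eta_k: "\<And>k. k \<ge> 1 \<Longrightarrow> \<eta> k = (\<eta> (k - 1) + eta_star) / 2"
    and T_k: "\<And>k. k \<ge> 1 \<Longrightarrow> T k = nat \<lceil>ln 4 / (mubar * \<eta> k)\<rceil>"
    and epoch_start: "\<And>k. \<tau> k = (\<Sum>j<k. T j)"
    and update: "\<And>k t \<omega>. k < K \<Longrightarrow> \<tau> k \<le> t \<Longrightarrow> t < \<tau> k + T k \<Longrightarrow> \<omega> \<in> space M \<Longrightarrow>
          x (Suc t) \<omega> = prox (\<eta> k) (r t \<omega>) (x t \<omega> - \<eta> k *\<^sub>R g t \<omega>)"
    and X: "\<And>k. X k = x (\<tau> k)"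
    and Ttot: "Ttot = (\<Sum>k<K. T k)"
  shows "real Ttot \<le> abs_const *
             (L / mubar * max (ln (mubar * L * D / \<sigma>\<^sup>2)) 0 + \<sigma>\<^sup>2 / (mubar\<^sup>2 * Err))
       \<and> L / mubar * max (ln (mubar * L * D / \<sigma>\<^sup>2)) 0 + \<sigma>\<^sup>2 / (mubar\<^sup>2 * Err)
           \<le> L / mubar * max (ln (D / Err)) 0 + \<sigma>\<^sup>2 / (mubar\<^sup>2 * Err)
       \<and> integrable M (\<lambda>\<omega>. (norm (X K \<omega> - xbar Ttot \<omega>))\<^sup>2)
       \<and> (\<integral>\<omega>. (norm (X K \<omega> - xbar Ttot \<omega>))\<^sup>2 \<partial>M) \<le> abs_const * Err"
proof -
  interpret P: decision_dependent_problem "space M" f r \<mu> L \<gamma> by (fact problem)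
  interpret S: stochastic_framework M F x xbar "gradient_noise f x g" by (fact framework)
  \<comment> \<open>The bounds on \<open>\<mu>\<close> and \<open>\<gamma>\<close> are stated per
    outcome, so one outcome must be exhibited.\<close>
  obtain \<omega>\<^sub>0 where \<omega>\<^sub>0: "\<omega>\<^sub>0 \<in> space M" using S.not_empty by blast
  have m_pos: "0 < mubar" using P.gamma_less_mu by (simp add: mubar)
  have m_le_L: "mubar \<le> L"
    using P.mu_le_L[OF \<omega>\<^sub>0] P.gamma_nonneg[OF \<omega>\<^sub>0] by (simp add: mubar)
  interpret step_schedule mubar L \<Delta> \<sigma> eta_star Err \<eta> T K
    by unfold_locales
      (fact m_pos P.L_pos m_le_L Delta_pos sigma_pos low_drift eta_star Err K eta_0 eta_k T_k)+
  let ?I = "\<lambda>t. integrable M (\<lambda>\<omega>. (norm (x t \<omega> - xbar t \<omega>))\<^sup>2)"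
  let ?E = "\<lambda>t. \<integral>\<omega>. (norm (x t \<omega> - xbar t \<omega>))\<^sup>2 \<partial>M"
  have [measurable]: "x 0 \<in> borel_measurable M" "xbar 0 \<in> borel_measurable M"
    using measurable_from_subalg[OF S.F_subalgebra] S.x_measurable S.xbar_measurable by blast+
  \<comment> \<open>\<open>D\<close> bounds the initial error at every outcome, which gives both its
    integrability and its expected bound.\<close>
  have I_0: "?I 0"
    by (rule S.integrable_const_bound[where B = D]) (use D in auto)
  have E_0: "?E 0 \<le> D"
    using integral_mono[OF I_0 S.integrable_const[of D]] D S.prob_space by simp
  have "?I (\<Sum>k<K. T k) \<and> ?E (\<Sum>k<K. T k) \<le> abs_const * Err"
  proof (rule epochs_error_le[where P = ?I and E = ?E, OF D_pos E_0 T_0 _ I_0])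
    fix k t assume k: "k < K" "(\<Sum>j<k. T j) \<le> t" "t < (\<Sum>j<k. T j) + T k" and I: "?I t"
    have \<eta>L: "\<eta> k * L \<le> 1 / 2" using eta_le[of k] P.L_pos by (simp add: field_simps)
    have "(1 + \<eta> k * mubar) * (norm (x (Suc t) \<omega> - xbar t \<omega>))\<^sup>2
        \<le> (1 - \<eta> k * mubar) * (norm (x t \<omega> - xbar t \<omega>))\<^sup>2
          + 2 * \<eta> k * (gradient_noise f x g t \<omega> \<bullet> (x t \<omega> - xbar t \<omega>))
          + 2 * (\<eta> k)\<^sup>2 * (norm (gradient_noise f x g t \<omega>))\<^sup>2" if \<omega>: "\<omega> \<in> space M" for \<omega>
      unfolding mubar gradient_noise_def
      using k \<omega> by (intro P.prox_gradient_step[OF \<omega> equilibrium[OF \<omega>] eta_pos \<eta>L update refl])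
        (simp_all add: epoch_start)
    from S.expected_tracking_step[OF eta_pos m_pos eta_m_le I conjunct1[OF drift]
        conjunct2[OF drift] conjunct1[OF noise] conjunct2[OF noise] this]
    show "?I (Suc t) \<and> ?E (Suc t) \<le> (1 - \<eta> k * mubar) * ?E t + 2 * (\<eta> k)\<^sup>2 * \<sigma>\<^sup>2
        + 3 / (2 * (\<eta> k * mubar)) * \<Delta>\<^sup>2" by blast
  qed simp
  then show ?thesis
    using horizon_le[OF _ T_0] log_term_le[OF D_pos] by (simp add: X epoch_start Ttot)
qed

end
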